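(* Let $N\in\mathbb{N}$ and let $z_0=-1$ or $z_0=0$. Assume that a function $F_2:[z_0,1)\to\mathbb{R}$ can be represented as $$F_2(x)=c_1(1-x)^{-1/2}+c_2(1-x)^{1/2}+\tilde F_2(x),\quad x\in[z_0,1),$$ where $c_1>0$, $c_2\in\mathbb{R}$, and $\tilde F_2\in C^1[z_0,1]$. Then there exist real constants $L_2=L_2(F_2,N)>0$, $L_2^*=L_2^*(F_2,N)>c_1$ and $l_2=l_2(F_2,N)$ such that, for all integers $n\ge N$, $$L_2^*\frac{1}{n^{1/2}}-l_2\frac1n\le\int_{z_0}^1F_2(x)\,dx-\sum_{k=z_0n}^{n-1}\frac1nF_2\left(\frac kn\right)\le L_2\frac{1}{n^{1/2}}.$$ In particular, $\left|\sum_{k=z_0n}^{n-1}\frac1nF_2\left(\frac kn\right)\right|$ is bounded uniformly in $n\ge N$.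
   Context: $\mathbb{N}$ denotes the positive integers. $C^1[z_0,1]$ denotes the continuously differentiable real-valued functions on the closed interval $[z_0,1]$ (one-sided derivatives at the endpoints). The integral $\int_{z_0}^1F_2(x)\,dx$ is the (absolutely convergent) improper, equivalently Lebesgue, integral. The notation $L_2(F_2,N)$, etc., means that the constant may depend on $F_2$ and $N$ (and on $z_0$), but not on $n$. *)

theory Defs
  imports "HOL-Analysis.Analysis"
begin

(* At the end points "at x within {a..b}" gives one-sided derivatives. The library's
   C1_differentiable_on asks for two-sided derivatives at every point of the set, so it
   would constrain f outside [a,b]. *)
definition C1_on_interval :: "(real \<Rightarrow> real) \<Rightarrow> real \<Rightarrow> real \<Rightarrow> bool" where
  "C1_on_interval f a b \<longleftrightarrow>
     (\<exists>f'. (\<forall>x\<in>{a..b}. (f has_real_derivative f' x) (at x within {a..b})) \<and>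
           continuous_on {a..b} f')"

definition left_riemann_sum :: "(real \<Rightarrow> real) \<Rightarrow> int \<Rightarrow> nat \<Rightarrow> real" where
  "left_riemann_sum F z n =
     (\<Sum>k = z * int n..int n - 1. 1 / real n * F (real_of_int k / real n))"

end

theory Submission
  imports Defs
begin

text \<open>The error of the left Riemann sum is linear in the function, so the three terms of \<open>F\<^sub>2\<close> can
  be treated separately.

  The term \<open>(1 - x) powr (-1/2)\<close> decides the order. It is homogeneous about the right end point:
  with \<open>j = n - k\<close> the node \<open>k/n\<close> lies at distance \<open>j/n\<close> from \<open>1\<close>, and integral and sum both scale
  exactly. The error therefore equals \<open>a m / sqrt n\<close>, where \<open>m = (1 - z\<^sub>0) n\<close> is the number of nodes and
  \<open>a m = 2 sqrt m - (\<Sum>j=1..m. 1 / sqrt j)\<close>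
  (lemma \<open>left_riemann_error_inverse_sqrt_gap\<close>). The sequence \<open>a\<close> is increasing and bounded by \<open>2\<close>,
  and it starts with \<open>a 1 = 1\<close>. That the leading constant can be taken strictly above \<open>c\<^sub>1\<close> comes from
  \<open>a 2 > 11/10\<close>; the case \<open>m = 1\<close> is repaired by the correction of order \<open>1/n\<close> that the lower
  bound permits (lemma \<open>inverse_sqrt_defect_ge\<close>).

  The other two terms contribute only \<open>O(1/n)\<close>, because they are combinations of continuous monotone
  functions. On each cell a nondecreasing function lies between its values at the two end points, and
  these differences telescope, so the error is at most the total increase divided by \<open>n\<close> (lemma
  \<open>riemann_sum_error_mono\<close>). The square root is monotone, and a \<open>C\<^sup>1\<close> function becomes nondecreasing
  after adding \<open>K x\<close> with \<open>K\<close> a bound for its derivative. Since \<open>1/n \<le> 1 / sqrt n\<close>, this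
  contribution fits into both sides of the estimate.\<close>

section \<open>Error of the left Riemann sum\<close>

definition left_riemann_error :: "(real \<Rightarrow> real) \<Rightarrow> int \<Rightarrow> nat \<Rightarrow> real" where
  "left_riemann_error F z n =
     (LINT x:{real_of_int z..<1}|lborel. F x) - left_riemann_sum F z n"

lemma left_riemann_sum_cong:
  assumes "n > 0" and "\<And>x. x \<in> {real_of_int z..<1} \<Longrightarrow> F x = H x"
  shows "left_riemann_sum F z n = left_riemann_sum H z n"
  unfolding left_riemann_sum_def
proof (rule sum.cong[OF refl])
  fix k assume k: "k \<in> {z * int n..int n - 1}"
  have "real_of_int (z * int n) \<le> real_of_int k" "real_of_int k \<le> real_of_int (int n - 1)"
    using k by (simp_all only: of_int_le_iff atLeastAtMost_iff)
  then have "real_of_int k / real n \<in> {real_of_int z..<1}"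
    using assms(1) by (simp add: field_simps)
  then show "1 / real n * F (real_of_int k / real n) = 1 / real n * H (real_of_int k / real n)"
    using assms(2) by simp
qed

lemma left_riemann_error_cong:
  assumes "n > 0" and "\<And>x. x \<in> {real_of_int z..<1} \<Longrightarrow> F x = H x"
  shows "left_riemann_error F z n = left_riemann_error H z n"
proof -
  have "(LINT x:{real_of_int z..<1}|lborel. F x) = (LINT x:{real_of_int z..<1}|lborel. H x)"
    by (rule set_lebesgue_integral_cong) (use assms(2) in auto)
  then show ?thesis
    using left_riemann_sum_cong[OF assms] by (simp add: left_riemann_error_def)
qed

lemma left_riemann_error_add:
  assumes "set_integrable lborel {real_of_int z..<1} F"
    and "set_integrable lborel {real_of_int z..<1} H"
  shows "left_riemann_error (\<lambda>x. F x + H x) z n = left_riemann_error F z n + left_riemann_error H z n"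
  using assms
  by (simp add: left_riemann_error_def left_riemann_sum_def distrib_left sum.distrib)

lemma left_riemann_error_cmult:
  "left_riemann_error (\<lambda>x. c * F x) z n = c * left_riemann_error F z n"
  by (simp add: left_riemann_error_def left_riemann_sum_def sum_distrib_left right_diff_distrib mult_ac)

text \<open>Counting the nodes from the right end point, where the singularity sits, gives all
  estimates below the index \<open>j = n - k\<close>, for which \<open>1 - k/n = j/n\<close>.\<close>

lemma left_riemann_sum_from_right:
  assumes "n > 0" and "z \<le> 1"
  shows "left_riemann_sum F z n = (\<Sum>j=1..nat (1 - z) * n. 1 / real n * F (1 - real j / real n))"
proof -
  have m: "int (nat (1 - z) * n) = int n - z * int n"
    using assms by (simp add: algebra_simps)
  show ?thesis
    unfolding left_riemann_sum_def
  proof (rule sum.reindex_bij_witness[where i = "\<lambda>j. int n - int j" and j = "\<lambda>k. nat (int n - k)"])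
    fix k assume "k \<in> {z * int n..int n - 1}"
    then have k: "z * int n \<le> k" "k \<le> int n - 1" by auto
    show "int n - int (nat (int n - k)) = k" using k by simp
    have "int (nat (int n - k)) \<le> int (nat (1 - z) * n)"
      unfolding m using k by simp
    moreover have "1 \<le> nat (int n - k)" using k by simp
    ultimately show "nat (int n - k) \<in> {1..nat (1 - z) * n}"
      by (simp only: atLeastAtMost_iff of_nat_le_iff)
    have "1 - real (nat (int n - k)) / real n = real_of_int k / real n"
      using k assms(1) by (simp add: field_simps)
    then show "1 / real n * F (1 - real (nat (int n - k)) / real n)
        = 1 / real n * F (real_of_int k / real n)"
      by simp
  next
    fix j assume j: "j \<in> {1..nat (1 - z) * n}"
    then have "int j \<le> int (nat (1 - z) * n)" by (simp only: atLeastAtMost_iff of_nat_le_iff)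
    then show "int n - int j \<in> {z * int n..int n - 1}" using j m by auto
    show "nat (int n - (int n - int j)) = j" by simp
  qed
qed

lemma set_lebesgue_integral_Ico_eq_integral:
  fixes f :: "real \<Rightarrow> real"
  assumes "set_integrable lborel {a..<b} f"
  shows "(LINT x:{a..<b}|lborel. f x) = integral {a..b} f"
proof -
  have "integral {a..<b} f = integral {a..b} f"
    by (rule integral_spike_set) (rule negligible_subset[of "{b}"], auto)+
  then show ?thesis using set_borel_integral_eq_integral(2)[OF assms] by simp
qed

lemma set_integrable_Ico_continuous:
  fixes f :: "real \<Rightarrow> real"
  assumes "continuous_on {a..b} f"
  shows "set_integrable lborel {a..<b} f"
  using borel_integrable_atLeastAtMost'[OF assms] by (rule set_integrable_subset) auto

section \<open>Monotone and continuously differentiable functions\<close>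

text \<open>A nondecreasing function on a cell \<open>[v, u]\<close> of width \<open>h\<close> has its integral between \<open>h * f v\<close> and
  \<open>h * f u\<close>; the cell errors, each in \<open>[0, h * (f u - f v)]\<close>, telescope.\<close>

lemma riemann_sum_error_mono:
  fixes f :: "real \<Rightarrow> real"
  assumes h: "h > 0" and mono: "mono_on {b - real m * h..b} f"
    and cont: "continuous_on {b - real m * h..b} f"
  shows "integral {b - real m * h..b} f - (\<Sum>j=1..m. h * f (b - real j * h))
           \<in> {0..h * (f b - f (b - real m * h))}"
  using mono cont
proof (induction m)
  case 0
  then show ?case by simp
next
  case (Suc m)
  define u where "u = b - real m * h"
  define v where "v = b - real (Suc m) * h"
  have uv: "v \<le> u" "u \<le> b" "u - v = h" using h by (auto simp: u_def v_def algebra_simps)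
  have sub: "{u..b} \<subseteq> {v..b}" using uv by auto
  have mono: "mono_on {v..b} f" and cont: "continuous_on {v..b} f"
    using Suc.prems by (simp_all only: v_def)
  have IH: "integral {u..b} f - (\<Sum>j=1..m. h * f (b - real j * h)) \<in> {0..h * (f b - f u)}"
    using Suc.IH[folded u_def] mono_on_subset[OF mono sub] continuous_on_subset[OF cont sub] by blast
  have int: "f integrable_on {v..b}" using cont by (rule integrable_continuous_real)
  have int_vu: "f integrable_on {v..u}"
    using integrable_on_subinterval[OF int, of v u] uv by auto
  have split: "integral {v..b} f = integral {v..u} f + integral {u..b} f"
    using Henstock_Kurzweil_Integration.integral_combine[OF uv(1,2) int] by simp
  have "h * f v = integral {v..u} (\<lambda>_. f v)" using uv by simp
  also have "\<dots> \<le> integral {v..u} f"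
    using uv int_vu by (intro integral_le mono_onD[OF mono]) auto
  finally have lo: "h * f v \<le> integral {v..u} f" .
  have "integral {v..u} f \<le> integral {v..u} (\<lambda>_. f u)"
    using uv int_vu by (intro integral_le mono_onD[OF mono]) auto
  also have "\<dots> = h * f u" using uv by simp
  finally have hi: "integral {v..u} f \<le> h * f u" .
  have "(\<Sum>j=1..Suc m. h * f (b - real j * h)) = (\<Sum>j=1..m. h * f (b - real j * h)) + h * f v"
    by (simp add: v_def)
  then show ?case
    using IH lo hi split unfolding v_def[symmetric]
    by (simp only: atLeastAtMost_iff right_diff_distrib) linarith
qed

lemma left_riemann_error_mono:
  assumes n: "n > 0" and z: "z \<le> 1"
    and mono: "mono_on {real_of_int z..1} f" and cont: "continuous_on {real_of_int z..1} f"
  shows "\<bar>left_riemann_error f z n\<bar> \<le> (f 1 - f (real_of_int z)) * (1 / real n)"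
proof -
  define m where "m = nat (1 - z) * n"
  have m: "1 - real m * (1 / real n) = real_of_int z"
    using n z by (simp add: m_def)
  have "integral {real_of_int z..1} f - (\<Sum>j=1..m. 1 / real n * f (1 - real j * (1 / real n)))
          \<in> {0..1 / real n * (f 1 - f (real_of_int z))}"
    using riemann_sum_error_mono[of "1 / real n" 1 m f] n mono cont unfolding m by simp
  moreover have "left_riemann_error f z n
      = integral {real_of_int z..1} f - (\<Sum>j=1..m. 1 / real n * f (1 - real j * (1 / real n)))"
    unfolding left_riemann_error_def left_riemann_sum_from_right[OF n z]
      set_lebesgue_integral_Ico_eq_integral[OF set_integrable_Ico_continuous[OF cont]] m_def
    by simp
  ultimately show ?thesis by (simp add: mult.commute)
qed

lemma C1_on_interval_continuous_on:
  assumes "C1_on_interval G a b"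
  shows "continuous_on {a..b} G"
  using assms unfolding C1_on_interval_def by (auto intro: DERIV_continuous_on)

lemma C1_on_interval_Lipschitz:
  assumes "C1_on_interval G a b"
  obtains K where "K \<ge> 0" "\<And>x y. x \<in> {a..b} \<Longrightarrow> y \<in> {a..b} \<Longrightarrow> \<bar>G x - G y\<bar> \<le> K * \<bar>x - y\<bar>"
proof -
  obtain G' where G': "\<And>x. x \<in> {a..b} \<Longrightarrow> (G has_real_derivative G' x) (at x within {a..b})"
    and cont: "continuous_on {a..b} G'"
    using assms unfolding C1_on_interval_def by blast
  have "bounded (G' ` {a..b})"
    using cont by (intro compact_imp_bounded compact_continuous_image) auto
  then obtain K where K: "K > 0" "\<And>x. x \<in> {a..b} \<Longrightarrow> norm (G' x) \<le> K"
    unfolding bounded_pos by auto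
  have "\<bar>G x - G y\<bar> \<le> K * \<bar>x - y\<bar>" if "x \<in> {a..b}" "y \<in> {a..b}" for x y
    using field_differentiable_bound[of "{a..b}" G G' K x y] G' K that by auto
  then show thesis using that K(1) by (meson less_imp_le)
qed

text \<open>A function with Lipschitz constant \<open>K\<close> is the difference of the nondecreasing functions
  \<open>G x + K x\<close> and \<open>K x\<close>, so the bound for monotone functions applies to it.\<close>

lemma left_riemann_error_C1:
  assumes z: "z \<le> 1" and G: "C1_on_interval G (real_of_int z) 1"
  obtains C where "\<And>n. n > 0 \<Longrightarrow> \<bar>left_riemann_error G z n\<bar> \<le> C * (1 / real n)"
proof -
  obtain K where K: "K \<ge> 0"
    "\<And>x y. x \<in> {real_of_int z..1} \<Longrightarrow> y \<in> {real_of_int z..1} \<Longrightarrow> \<bar>G x - G y\<bar> \<le> K * \<bar>x - y\<bar>"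
    using C1_on_interval_Lipschitz[OF G] by blast
  note cont = C1_on_interval_continuous_on[OF G]
  let ?H = "\<lambda>x. G x + K * x"
  have mono_H: "mono_on {real_of_int z..1} ?H"
  proof (rule mono_onI)
    fix x y assume xy: "x \<in> {real_of_int z..1}" "y \<in> {real_of_int z..1}" "x \<le> y"
    have "G x - G y \<le> K * (y - x)" using K(2)[OF xy(1,2)] xy(3) by simp
    then show "?H x \<le> ?H y" by (simp add: right_diff_distrib)
  qed
  have mono_K: "mono_on {real_of_int z..1} (\<lambda>x. K * x)"
    using K(1) by (intro mono_onI mult_left_mono)
  have cont_H: "continuous_on {real_of_int z..1} ?H"
    and cont_K: "continuous_on {real_of_int z..1} (\<lambda>x. K * x)"
    by (intro continuous_on_add cont continuous_on_mult_left continuous_on_id)+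
  define C where "C = (?H 1 - ?H (real_of_int z)) + (K * 1 - K * real_of_int z)"
  have "\<bar>left_riemann_error G z n\<bar> \<le> C * (1 / real n)" if n: "n > 0" for n
  proof -
    have "left_riemann_error ?H z n = left_riemann_error G z n + left_riemann_error (\<lambda>x. K * x) z n"
      using cont cont_K by (intro left_riemann_error_add set_integrable_Ico_continuous)
    then show ?thesis
      using left_riemann_error_mono[OF n z mono_H cont_H] left_riemann_error_mono[OF n z mono_K cont_K]
      unfolding C_def by (simp only: distrib_right)
  qed
  then show thesis by (rule that)
qed

lemma left_riemann_error_sqrt_gap:
  assumes n: "n > 0" and z: "z \<le> 1"
  shows "\<bar>left_riemann_error (\<lambda>x. (1 - x) powr (1/2)) z n\<bar> \<le> sqrt (1 - real_of_int z) * (1 / real n)"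
proof -
  let ?f = "\<lambda>x::real. - sqrt (1 - x)"
  have "\<bar>left_riemann_error ?f z n\<bar> \<le> (?f 1 - ?f (real_of_int z)) * (1 / real n)"
    by (rule left_riemann_error_mono[OF n z]) (auto intro!: mono_onI continuous_intros)
  moreover have "left_riemann_error ?f z n = - left_riemann_error (\<lambda>x. sqrt (1 - x)) z n"
    using left_riemann_error_cmult[of "-1" "\<lambda>x. sqrt (1 - x)" z n] by simp
  moreover have "left_riemann_error (\<lambda>x. (1 - x) powr (1/2)) z n
      = left_riemann_error (\<lambda>x. sqrt (1 - x)) z n"
    by (rule left_riemann_error_cong[OF n]) (simp add: powr_half_sqrt)
  ultimately show ?thesis by simp
qed

section \<open>Partial sums of the inverse square roots\<close>

text \<open>The rescaled error of the left Riemann sum for \<open>(1 - x) powr (-1/2)\<close> with \<open>m\<close> nodes; its limit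
  is \<open>-\<zeta>(1/2)\<close>.\<close>

definition inverse_sqrt_defect :: "nat \<Rightarrow> real" where
  "inverse_sqrt_defect m = 2 * sqrt (real m) - (\<Sum>j=1..m. 1 / sqrt (real j))"

lemma inverse_sqrt_defect_Suc:
  "inverse_sqrt_defect m \<le> inverse_sqrt_defect (Suc m)"
proof -
  define s t where "s = sqrt (real m)" and "t = sqrt (real (Suc m))"
  have t: "t > 0" "t\<^sup>2 - s\<^sup>2 = 1" unfolding s_def t_def by simp_all
  \<comment> \<open>The claim is \<open>1/t \<le> 2 (t - s)\<close>; after multiplication by \<open>t\<close> this reads
      \<open>t\<^sup>2 - s\<^sup>2 \<le> 2 t\<^sup>2 - 2 s t\<close>.\<close>
  have "0 \<le> (t - s)\<^sup>2" by simp
  then have "1 \<le> 2 * (t - s) * t"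
    using t(2) by (simp add: power2_eq_square algebra_simps)
  then have "1 / t \<le> 2 * (t - s)" using t(1) by (simp add: divide_le_eq)
  then show ?thesis unfolding inverse_sqrt_defect_def s_def t_def by simp
qed

lemma inverse_sqrt_defect_le: "inverse_sqrt_defect m \<le> 2"
proof -
  have "inverse_sqrt_defect m \<le> 2 + 2 * sqrt (real m) - 2 * sqrt (real (Suc m))"
  proof (induction m)
    case 0
    then show ?case by (simp add: inverse_sqrt_defect_def)
  next
    case (Suc m)
    define s t where "s = sqrt (real (Suc m))" and "t = sqrt (real (Suc (Suc m)))"
    have s: "s > 0" "t\<^sup>2 - s\<^sup>2 = 1" unfolding s_def t_def by simp_all
    have "0 \<le> (t - s)\<^sup>2" by simp
    then have "2 * (t - s) * s \<le> 1"
      using s(2) by (simp add: power2_eq_square algebra_simps)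
    then have "2 * (t - s) \<le> 1 / s" using s(1) by (simp add: le_divide_eq)
    then show ?case using Suc unfolding inverse_sqrt_defect_def s_def t_def by simp
  qed
  moreover have "sqrt (real m) \<le> sqrt (real (Suc m))" by simp
  ultimately show ?thesis by linarith
qed

text \<open>The defect is \<open>1\<close> at \<open>m = 1\<close> and \<open>3/\<surd>2 - 1 > 11/10\<close> at \<open>m = 2\<close>. The single
  value at \<open>m = 1\<close>, too small for a constant above \<open>1\<close>, is absorbed by a
  term of order \<open>1 / sqrt m\<close>, which the factor \<open>1 / sqrt n\<close> of the error turns into order \<open>1/n\<close>.\<close>

lemma inverse_sqrt_defect_ge:
  assumes "m \<ge> 1"
  shows "11/10 - 1/10 * (1 / sqrt (real m)) \<le> inverse_sqrt_defect m"
proof (cases "m = 1")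
  case True
  then show ?thesis by (simp add: inverse_sqrt_defect_def)
next
  case False
  have "1.4 \<le> sqrt 2" by (rule real_le_rsqrt) (simp add: power2_eq_square)
  moreover have "1 / sqrt 2 = sqrt 2 / 2" by (simp add: real_div_sqrt field_simps)
  ultimately have "11/10 \<le> inverse_sqrt_defect 2"
    by (simp add: inverse_sqrt_defect_def numeral_2_eq_2)
  also have "\<dots> \<le> inverse_sqrt_defect m"
    by (rule lift_Suc_mono_le) (use inverse_sqrt_defect_Suc False assms in auto)
  finally have "11/10 \<le> inverse_sqrt_defect m" .
  moreover have "0 \<le> 1/10 * (1 / sqrt (real m))" by simp
  ultimately show ?thesis by linarith
qed

section \<open>The inverse square root singularity\<close>

text \<open>The primitive \<open>-2 sqrt (1 - x)\<close> is continuous up to the singular point, so the fundamental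
  theorem with a derivative required only in the interior gives the gauge integral; as the integrand
  is nonnegative, this is also its Lebesgue integral.\<close>

lemma inverse_sqrt_gap_integral:
  assumes "a \<le> 1"
  shows "set_integrable lborel {a..<1} (\<lambda>x::real. (1 - x) powr (-1/2))"
    and "(LINT x:{a..<1}|lborel. (1 - x) powr (-1/2)) = 2 * sqrt (1 - a)"
proof -
  let ?f = "\<lambda>x::real. (1 - x) powr (-1/2)"
  let ?P = "\<lambda>x::real. - 2 * sqrt (1 - x)"
  have "(?f has_integral (?P 1 - ?P a)) {a..1}"
  proof (rule fundamental_theorem_of_calculus_interior[OF assms])
    show "continuous_on {a..1} ?P" by (intro continuous_intros)
    fix x :: real assume "x \<in> {a<..<1}"
    then have x: "1 - x > 0" by simp
    have "1 / sqrt (1 - x) = ?f x"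
      using x by (simp add: powr_minus_divide powr_half_sqrt)
    moreover have "(?P has_real_derivative 1 / sqrt (1 - x)) (at x)"
      using x by (auto intro!: derivative_eq_intros simp: field_simps)
    ultimately show "(?P has_vector_derivative ?f x) (at x)"
      by (simp add: has_real_derivative_iff_has_vector_derivative)
  qed
  then have int: "(?f has_integral (2 * sqrt (1 - a))) {a..1}" by simp
  then have "set_integrable lebesgue {a..1} ?f"
    by (intro nonnegative_absolutely_integrable_1) auto
  then have "set_integrable lborel {a..1} ?f"
    unfolding set_integrable_def by (subst (asm) integrable_completion) auto
  then show integrable: "set_integrable lborel {a..<1} ?f"
    by (rule set_integrable_subset) auto
  show "(LINT x:{a..<1}|lborel. ?f x) = 2 * sqrt (1 - a)"
    using set_lebesgue_integral_Ico_eq_integral[OF integrable] integral_unique[OF int] by simp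
qed

text \<open>With \<open>j\<close> counting from \<open>1\<close>, every summand is \<open>(1/n) sqrt (n/j) = (1 / sqrt j) (1 / sqrt n)\<close>, and
  the integral is \<open>2 sqrt (1 - z) = 2 sqrt m / sqrt n\<close>: the factor \<open>1 / sqrt n\<close> splits off exactly.\<close>

lemma left_riemann_error_inverse_sqrt_gap:
  assumes n: "n > 0" and z: "z \<le> 1"
  shows "left_riemann_error (\<lambda>x. (1 - x) powr (-1/2)) z n
           = inverse_sqrt_defect (nat (1 - z) * n) * (1 / sqrt (real n))"
proof -
  define m where "m = nat (1 - z) * n"
  have m: "real m = (1 - real_of_int z) * real n" using z by (simp add: m_def)
  have r: "sqrt (real n) > 0" "sqrt (real n) * sqrt (real n) = real n" using n by simp_all
  have int: "2 * sqrt (1 - real_of_int z) = 2 * sqrt (real m) * (1 / sqrt (real n))"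
    using r(1) by (simp add: m real_sqrt_mult)
  have "left_riemann_sum (\<lambda>x. (1 - x) powr (-1/2)) z n
      = (\<Sum>j=1..m. 1 / real n * (real j / real n) powr (-1/2))"
    unfolding left_riemann_sum_from_right[OF n z] m_def by simp
  also have "\<dots> = (\<Sum>j=1..m. 1 / sqrt (real j) * (1 / sqrt (real n)))"
  proof (rule sum.cong[OF refl])
    fix j assume "j \<in> {1..m}"
    then have "(real j / real n) powr (-1/2) = sqrt (real n) / sqrt (real j)"
      by (simp add: powr_minus_divide powr_half_sqrt real_sqrt_divide)
    moreover have "1 / real n * sqrt (real n) = 1 / sqrt (real n)"
      using r by (simp add: field_simps)
    ultimately show "1 / real n * (real j / real n) powr (-1/2) = 1 / sqrt (real j) * (1 / sqrt (real n))"
      by (simp add: mult.commute)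
  qed
  also have "\<dots> = (\<Sum>j=1..m. 1 / sqrt (real j)) * (1 / sqrt (real n))"
    by (simp only: sum_distrib_right)
  finally have "left_riemann_sum (\<lambda>x. (1 - x) powr (-1/2)) z n
      = (\<Sum>j=1..m. 1 / sqrt (real j)) * (1 / sqrt (real n))" .
  then show ?thesis
    using inverse_sqrt_gap_integral(2)[of "real_of_int z"] z int
    unfolding left_riemann_error_def inverse_sqrt_defect_def m_def[symmetric]
    by (simp add: diff_divide_distrib)
qed

section \<open>Two-sided error estimate\<close>

theorem proposition2:
  fixes N :: nat and z\<^sub>0 :: int and F\<^sub>2 G :: "real \<Rightarrow> real" and c\<^sub>1 c\<^sub>2 :: real
  assumes "N \<ge> 1"
    and "z\<^sub>0 = -1 \<or> z\<^sub>0 = 0"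
    and "c\<^sub>1 > 0"
    and "C1_on_interval G (real_of_int z\<^sub>0) 1"
    and "\<And>x. x \<in> {real_of_int z\<^sub>0..<1} \<Longrightarrow>
           F\<^sub>2 x = c\<^sub>1 * (1 - x) powr (-1/2) + c\<^sub>2 * (1 - x) powr (1/2) + G x"
  shows "set_integrable lborel {real_of_int z\<^sub>0..<1} F\<^sub>2 \<and>
         (\<exists>L L' l :: real. L > 0 \<and> L' > c\<^sub>1 \<and>
           (\<forall>n\<ge>N.
              L' * (1 / real n powr (1/2)) - l * (1 / real n)
                \<le> (LINT x:{real_of_int z\<^sub>0..<1}|lborel. F\<^sub>2 x) - left_riemann_sum F\<^sub>2 z\<^sub>0 n \<and>
              (LINT x:{real_of_int z\<^sub>0..<1}|lborel. F\<^sub>2 x) - left_riemann_sum F\<^sub>2 z\<^sub>0 n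
                \<le> L * (1 / real n powr (1/2)))) \<and>
         (\<exists>B :: real. \<forall>n\<ge>N. \<bar>left_riemann_sum F\<^sub>2 z\<^sub>0 n\<bar> \<le> B)"
proof -
  let ?A = "{real_of_int z\<^sub>0..<1}"
  let ?p = "\<lambda>x::real. (1 - x) powr (-1/2)"
  let ?q = "\<lambda>x::real. (1 - x) powr (1/2)"
  have z: "z\<^sub>0 \<le> 1" "z\<^sub>0 \<le> 0" using assms(2) by auto

  have int_p: "set_integrable lborel ?A (\<lambda>x. c\<^sub>1 * ?p x)"
    using inverse_sqrt_gap_integral(1)[of "real_of_int z\<^sub>0"] z by simp
  have "continuous_on {real_of_int z\<^sub>0..1} (\<lambda>x. sqrt (1 - x))" by (intro continuous_intros)
  then have "continuous_on {real_of_int z\<^sub>0..1} ?q"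
    by (rule continuous_on_eq) (simp add: powr_half_sqrt)
  then have int_q: "set_integrable lborel ?A (\<lambda>x. c\<^sub>2 * ?q x)"
    by (intro set_integrable_Ico_continuous continuous_on_mult_left)
  have int_G: "set_integrable lborel ?A G"
    by (intro set_integrable_Ico_continuous C1_on_interval_continuous_on assms(4))
  note int_pq = set_integral_add(1)[OF int_p int_q]
  have "set_integrable lborel ?A F\<^sub>2 \<longleftrightarrow>
      set_integrable lborel ?A (\<lambda>x. c\<^sub>1 * ?p x + c\<^sub>2 * ?q x + G x)"
    by (rule set_integrable_cong[OF refl refl]) (use assms(5) in auto)
  then have integrable: "set_integrable lborel ?A F\<^sub>2"
    using set_integral_add(1)[OF int_pq int_G] by simp

  obtain C\<^sub>G where C\<^sub>G: "\<And>n. n > 0 \<Longrightarrow> \<bar>left_riemann_error G z\<^sub>0 n\<bar> \<le> C\<^sub>G * (1 / real n)"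
    using left_riemann_error_C1[OF z(1) assms(4)] by blast
  define C where "C = \<bar>c\<^sub>2\<bar> * sqrt (1 - real_of_int z\<^sub>0) + \<bar>C\<^sub>G\<bar>"
  have C_nonneg: "C \<ge> 0" unfolding C_def using z by simp

  have bounds: "11/10 * c\<^sub>1 * (1 / sqrt (real n)) - (1/10 * c\<^sub>1 + C) * (1 / real n)
        \<le> left_riemann_error F\<^sub>2 z\<^sub>0 n"
      "left_riemann_error F\<^sub>2 z\<^sub>0 n \<le> (2 * c\<^sub>1 + C) * (1 / sqrt (real n))" if n: "n \<ge> 1" for n
  proof -
    define m where "m = nat (1 - z\<^sub>0) * n"
    define r where "r = left_riemann_error (\<lambda>x. c\<^sub>2 * ?q x) z\<^sub>0 n + left_riemann_error G z\<^sub>0 n"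
    have n0: "n > 0" using n by simp
    have nm: "n \<le> m" unfolding m_def using assms(2) by auto
    have s: "sqrt (real n) \<ge> 1" "sqrt (real n) * sqrt (real n) = real n" using n by simp_all
    have "left_riemann_error F\<^sub>2 z\<^sub>0 n = left_riemann_error (\<lambda>x. c\<^sub>1 * ?p x + c\<^sub>2 * ?q x + G x) z\<^sub>0 n"
      by (rule left_riemann_error_cong[OF n0]) (use assms(5) in auto)
    also have "\<dots> = left_riemann_error (\<lambda>x. c\<^sub>1 * ?p x) z\<^sub>0 n + r"
      unfolding r_def using left_riemann_error_add[OF int_pq int_G] left_riemann_error_add[OF int_p int_q]
      by simp
    also have "\<dots> = c\<^sub>1 * inverse_sqrt_defect m * (1 / sqrt (real n)) + r"
      by (simp only: left_riemann_error_cmult left_riemann_error_inverse_sqrt_gap[OF n0 z(1)]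
        m_def mult.assoc)
    finally have err: "left_riemann_error F\<^sub>2 z\<^sub>0 n
        = c\<^sub>1 * inverse_sqrt_defect m * (1 / sqrt (real n)) + r" .

    have "\<bar>left_riemann_error (\<lambda>x. c\<^sub>2 * ?q x) z\<^sub>0 n\<bar>
        \<le> \<bar>c\<^sub>2\<bar> * (sqrt (1 - real_of_int z\<^sub>0) * (1 / real n))"
      unfolding left_riemann_error_cmult abs_mult
      by (intro mult_left_mono left_riemann_error_sqrt_gap n0 z) simp
    moreover have "C\<^sub>G * (1 / real n) \<le> \<bar>C\<^sub>G\<bar> * (1 / real n)" by (intro mult_right_mono) auto
    ultimately have r: "\<bar>r\<bar> \<le> C * (1 / real n)"
      using C\<^sub>G[OF n0] unfolding r_def C_def by (simp only: distrib_right mult.assoc)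
    have "1 / real n \<le> 1 / sqrt (real n)"
      using s n by (intro divide_left_mono) (auto simp: real_le_lsqrt power2_eq_square)
    then have Cn: "C * (1 / real n) \<le> C * (1 / sqrt (real n))"
      using C_nonneg by (rule mult_left_mono)

    have "c\<^sub>1 * inverse_sqrt_defect m * (1 / sqrt (real n)) \<le> c\<^sub>1 * 2 * (1 / sqrt (real n))"
      using assms(3) by (intro mult_right_mono mult_left_mono inverse_sqrt_defect_le) auto
    then show "left_riemann_error F\<^sub>2 z\<^sub>0 n \<le> (2 * c\<^sub>1 + C) * (1 / sqrt (real n))"
      using err r Cn by (simp only: distrib_right mult.commute[of 2 c\<^sub>1])

    have "1 / sqrt (real m) \<le> 1 / sqrt (real n)"
      using nm n by (intro divide_left_mono) auto
    then have "11/10 - 1/10 * (1 / sqrt (real n)) \<le> inverse_sqrt_defect m"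
      using inverse_sqrt_defect_ge[of m] nm n by linarith
    then have "c\<^sub>1 * (11/10 - 1/10 * (1 / sqrt (real n))) * (1 / sqrt (real n))
        \<le> c\<^sub>1 * inverse_sqrt_defect m * (1 / sqrt (real n))"
      using assms(3) by (intro mult_right_mono mult_left_mono) auto
    moreover have "c\<^sub>1 * (11/10 - 1/10 * (1 / sqrt (real n))) * (1 / sqrt (real n))
        = 11/10 * c\<^sub>1 * (1 / sqrt (real n)) - 1/10 * c\<^sub>1 * (1 / real n)"
      using s by (simp add: field_simps)
    ultimately show "11/10 * c\<^sub>1 * (1 / sqrt (real n)) - (1/10 * c\<^sub>1 + C) * (1 / real n)
        \<le> left_riemann_error F\<^sub>2 z\<^sub>0 n"
      using err r by (simp only: distrib_right)
  qed

  define I where "I = (LINT x:?A|lborel. F\<^sub>2 x)"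
  have S: "\<bar>left_riemann_sum F\<^sub>2 z\<^sub>0 n\<bar> \<le> \<bar>I\<bar> + (2 * c\<^sub>1 + C)" if n: "n \<ge> N" for n
  proof -
    have n1: "n \<ge> 1" using n assms(1) by simp
    note bounds(2)[OF n1]
    also have "(2 * c\<^sub>1 + C) * (1 / sqrt (real n)) \<le> (2 * c\<^sub>1 + C) * 1"
      using n1 assms(3) C_nonneg by (intro mult_left_mono) auto
    finally have upper: "left_riemann_error F\<^sub>2 z\<^sub>0 n \<le> 2 * c\<^sub>1 + C" by simp
    have "(1/10 * c\<^sub>1 + C) * (1 / real n) \<le> (1/10 * c\<^sub>1 + C) * 1"
      using n1 assms(3) C_nonneg by (intro mult_left_mono) auto
    then have "- (1/10 * c\<^sub>1 + C) \<le> 0 - (1/10 * c\<^sub>1 + C) * (1 / real n)" by simp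
    also have "\<dots> \<le> 11/10 * c\<^sub>1 * (1 / sqrt (real n)) - (1/10 * c\<^sub>1 + C) * (1 / real n)"
      using assms(3) by (intro diff_right_mono) simp
    also note bounds(1)[OF n1]
    finally have lower: "- (1/10 * c\<^sub>1 + C) \<le> left_riemann_error F\<^sub>2 z\<^sub>0 n" .
    have "left_riemann_sum F\<^sub>2 z\<^sub>0 n = I - left_riemann_error F\<^sub>2 z\<^sub>0 n"
      by (simp add: I_def left_riemann_error_def)
    then show ?thesis using upper lower assms(3) by linarith
  qed

  show ?thesis
  proof (intro conjI exI allI impI)
    show "set_integrable lborel ?A F\<^sub>2" by (rule integrable)
    show "2 * c\<^sub>1 + C > 0" "11/10 * c\<^sub>1 > c\<^sub>1" using assms(3) C_nonneg by simp_all
  next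
    fix n assume "N \<le> n"
    then have n: "n \<ge> 1" using assms(1) by simp
    show "11/10 * c\<^sub>1 * (1 / real n powr (1/2)) - (1/10 * c\<^sub>1 + C) * (1 / real n)
        \<le> (LINT x:?A|lborel. F\<^sub>2 x) - left_riemann_sum F\<^sub>2 z\<^sub>0 n"
      using bounds(1)[OF n] by (simp add: left_riemann_error_def powr_half_sqrt)
    show "(LINT x:?A|lborel. F\<^sub>2 x) - left_riemann_sum F\<^sub>2 z\<^sub>0 n
        \<le> (2 * c\<^sub>1 + C) * (1 / real n powr (1/2))"
      using bounds(2)[OF n] by (simp add: left_riemann_error_def powr_half_sqrt)
  next
    fix n assume "N \<le> n"
    then show "\<bar>left_riemann_sum F\<^sub>2 z\<^sub>0 n\<bar> \<le> \<bar>I\<bar> + (2 * c\<^sub>1 + C)" by (rule S)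
  qed
qed

end
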